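(* There exist finite sets $Q,S$, integers $\alpha,\beta\ge 0$ and an automaton $\psi:Q\times S^{\alpha+1}\to S$, $\phi:Q\times S^{\beta+1}\to Q$ which is not Mealy (that is, for some $q\in Q$ and some $N\ge 1$ the first $N$ letters of ${\bf A}_q(\bar s)$ are not determined by the first $N$ letters of $\bar s$), and such that for every $q\in Q$ the map ${\bf A}_q:X_S\to X_S$ is an isomorphism (a homeomorphism) of $X_S$, the boundary of the rooted regular $|S|$-ary tree.
   Context: An automaton over finite sets $Q$ (states) and $S$ (alphabet) is a pair of maps $\psi:Q\times S^{\alpha+1}\to S$, $\phi:Q\times S^{\beta+1}\to Q$ with $\alpha,\beta\ge0$. Let $X_S=\{(s_0,s_1,\dots):s_i\in S\}$ with the product topology; it is identified with the boundary of the rooted regular $|S|$-ary tree. Each $q\in Q$ determines a continuous map ${\bf A}_q:X_S\to X_S$, ${\bf A}_q(s_0,s_1,\dots)=(s_0',s_1',\dots)$, inductively by $q_0=q$, $s_i'=\psi(q_i,s_i,\dots,s_{i+\alpha})$, $q_{i+1}=\phi(q_i,s_i,\dots,s_{i+\beta})$. The Mealy case is $\alpha=\beta=0$; Mealy automata act level by level on the tree, i.e. the first $N$ output letters are determined by the first $N$ input letters for every $N$. *)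

theory Defs
  imports "HOL-Analysis.Analysis"
begin

text \<open>The alphabet S carries the discrete topology; the points of the product are exactly the
  sequences with all entries in S.\<close>

definition seq_space :: "'s set \<Rightarrow> (nat \<Rightarrow> 's) topology" where
  "seq_space S = product_topology (\<lambda>_. discrete_topology S) UNIV"

text \<open>Tuples in the cartesian power of S with exponent \<open>n\<close> are encoded as lists of length \<open>n\<close>.\<close>

definition words :: "nat \<Rightarrow> 's set \<Rightarrow> 's list set" where
  "words n S = {w. length w = n \<and> set w \<subseteq> S}"

definition automaton ::
    "'q set \<Rightarrow> 's set \<Rightarrow> nat \<Rightarrow> nat \<Rightarrow> ('q \<Rightarrow> 's list \<Rightarrow> 's) \<Rightarrow> ('q \<Rightarrow> 's list \<Rightarrow> 'q) \<Rightarrow> bool" where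
  "automaton Q S \<alpha> \<beta> \<psi> \<phi> \<longleftrightarrow>
     finite Q \<and> finite S \<and>
     (\<forall>q\<in>Q. \<forall>w\<in>words (\<alpha> + 1) S. \<psi> q w \<in> S) \<and>
     (\<forall>q\<in>Q. \<forall>w\<in>words (\<beta> + 1) S. \<phi> q w \<in> Q)"

primrec state_at ::
    "nat \<Rightarrow> ('q \<Rightarrow> 's list \<Rightarrow> 'q) \<Rightarrow> 'q \<Rightarrow> (nat \<Rightarrow> 's) \<Rightarrow> nat \<Rightarrow> 'q" where
  "state_at \<beta> \<phi> q s 0 = q"
| "state_at \<beta> \<phi> q s (Suc i) = \<phi> (state_at \<beta> \<phi> q s i) (map s [i..<i + \<beta> + 1])"

definition action ::
    "nat \<Rightarrow> nat \<Rightarrow> ('q \<Rightarrow> 's list \<Rightarrow> 's) \<Rightarrow> ('q \<Rightarrow> 's list \<Rightarrow> 'q) \<Rightarrow> 'q \<Rightarrow> (nat \<Rightarrow> 's) \<Rightarrow> (nat \<Rightarrow> 's)" where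
  "action \<alpha> \<beta> \<psi> \<phi> q s = (\<lambda>i. \<psi> (state_at \<beta> \<phi> q s i) (map s [i..<i + \<alpha> + 1]))"

text \<open>Being Mealy is understood through the action on sequences, not through the parameters:
  an automaton with positive \<open>\<alpha>\<close> or \<open>\<beta>\<close> whose maps all act level by level on the tree
  counts as Mealy.\<close>

definition mealy_action ::
    "'q set \<Rightarrow> 's set \<Rightarrow> nat \<Rightarrow> nat \<Rightarrow> ('q \<Rightarrow> 's list \<Rightarrow> 's) \<Rightarrow> ('q \<Rightarrow> 's list \<Rightarrow> 'q) \<Rightarrow> bool" where
  "mealy_action Q S \<alpha> \<beta> \<psi> \<phi> \<longleftrightarrow>
     (\<forall>q\<in>Q. \<forall>N\<ge>1. \<forall>s\<in>topspace (seq_space S). \<forall>t\<in>topspace (seq_space S).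
        (\<forall>i<N. s i = t i) \<longrightarrow>
        (\<forall>i<N. action \<alpha> \<beta> \<psi> \<phi> q s i = action \<alpha> \<beta> \<psi> \<phi> q t i))"

end

theory Submission
  imports Defs
begin

text \<open>A single state suffices: over the alphabet \<open>{0, 1, 2}\<close>, exchange 0 and 1 whenever the next
  letter is 2. The positions of the letter 2 do not change, so the map is an involution, yet
  the first output letter depends on the second input letter.\<close>

definition flip_before2 :: "nat \<Rightarrow> nat \<Rightarrow> nat" where
  "flip_before2 x y = (if y = 2 \<and> x < 2 then 1 - x else x)"

lemma flip_before2_closed: "x \<in> {0, 1, 2} \<Longrightarrow> flip_before2 x y \<in> {0, 1, 2}"
  by (auto simp: flip_before2_def)

text \<open>Whatever \<open>z\<close> is, \<open>flip_before2 y z\<close> equals 2 exactly when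
  \<open>y\<close> does, since only 0 and 1 are ever exchanged. Both applications therefore make the
  same decision about \<open>x\<close>, and swapping twice restores it.\<close>

lemma flip_before2_involution:
  "flip_before2 (flip_before2 x y) (flip_before2 y z) = x"
  by (auto simp: flip_before2_def)

lemma topspace_seq_space: "topspace (seq_space S) = {s. \<forall>i. s i \<in> S}"
  by (auto simp: seq_space_def)

text \<open>Each output coordinate factors through the projection to two input coordinates, whose
  values lie in a discrete space.\<close>

lemma continuous_map_seq_space_sliding_pair:
  assumes "\<And>x y. x \<in> S \<Longrightarrow> y \<in> S \<Longrightarrow> f x y \<in> S"
  shows "continuous_map (seq_space S) (seq_space S) (\<lambda>s i. f (s i) (s (Suc i)))"
proof -
  have "continuous_map (seq_space S) (discrete_topology S) (\<lambda>s. f (s i) (s (Suc i)))" for i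
  proof -
    have "continuous_map (seq_space S) (prod_topology (discrete_topology S) (discrete_topology S))
        (\<lambda>s. (s i, s (Suc i)))"
      unfolding seq_space_def
      by (intro continuous_map_pairedI continuous_map_product_projection) auto
    \<comment> \<open>A product of two discrete spaces is discrete, so only closure of
      \<open>S\<close> under \<open>f\<close> has to be checked.\<close>
    moreover have "continuous_map (prod_topology (discrete_topology S) (discrete_topology S))
        (discrete_topology S) (\<lambda>(x, y). f x y)"
      using assms by (auto simp flip: prod_topology_discrete_topology)
    ultimately show ?thesis
      using continuous_map_compose by (fastforce simp: o_def)
  qed
  then show ?thesis
    by (subst (2) seq_space_def) (simp add: continuous_map_componentwise_UNIV)
qed

theorem lemma1p1:
  "\<exists>(Q :: nat set) (S :: nat set) (\<alpha> :: nat) (\<beta> :: nat)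
      (\<psi> :: nat \<Rightarrow> nat list \<Rightarrow> nat) (\<phi> :: nat \<Rightarrow> nat list \<Rightarrow> nat).
     automaton Q S \<alpha> \<beta> \<psi> \<phi> \<and>
     \<not> mealy_action Q S \<alpha> \<beta> \<psi> \<phi> \<and>
     (\<forall>q\<in>Q. homeomorphic_map (seq_space S) (seq_space S) (action \<alpha> \<beta> \<psi> \<phi> q))"
proof -
  \<comment> \<open>With \<alpha> = 1 the window \<open>w\<close> consists of the current letter and
    the next one.\<close>
  define \<psi> :: "nat \<Rightarrow> nat list \<Rightarrow> nat" where "\<psi> = (\<lambda>q w. flip_before2 (w ! 0) (w ! 1))"
  define \<phi> :: "nat \<Rightarrow> nat list \<Rightarrow> nat" where "\<phi> = (\<lambda>q w. 0)"
  let ?S = "{0, 1, 2 :: nat}"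
  let ?T = "action 1 0 \<psi> \<phi> 0"
  have T: "?T = (\<lambda>s i. flip_before2 (s i) (s (Suc i)))"
    by (simp add: fun_eq_iff action_def \<psi>_def del: upt_Suc)
  have "\<psi> q w \<in> ?S" if "w \<in> words (1 + 1) ?S" for q w
  proof -
    have "w ! 0 \<in> set w" "set w \<subseteq> ?S"
      using that by (auto simp: words_def intro!: nth_mem)
    then show ?thesis
      unfolding \<psi>_def by (intro flip_before2_closed) blast
  qed
  then have "automaton {0} ?S 1 0 \<psi> \<phi>"
    by (simp add: automaton_def \<phi>_def)
  moreover have "\<not> mealy_action {0} ?S 1 0 \<psi> \<phi>"
  proof
    \<comment> \<open>Level-by-level action fails already at N = 1: both sequences start with 0, but
      the 2 that follows in \<open>t\<close> turns its first output letter into 1, while that of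
      \<open>s\<close> stays 0.\<close>
    define s :: "nat \<Rightarrow> nat" where "s = (\<lambda>_. 0)"
    define t :: "nat \<Rightarrow> nat" where "t = (\<lambda>i. if i = 0 then 0 else 2)"
    assume "mealy_action {0} ?S 1 0 \<psi> \<phi>"
    moreover have "s \<in> topspace (seq_space ?S)" "t \<in> topspace (seq_space ?S)"
      by (auto simp: topspace_seq_space s_def t_def)
    moreover have "\<forall>i<1. s i = t i"
      by (simp add: s_def t_def)
    ultimately have "?T s 0 = ?T t 0"
      unfolding mealy_action_def by (metis insertI1 order_refl zero_less_one)
    then show False
      unfolding T by (simp add: s_def t_def flip_before2_def)
  qed
  moreover have "homeomorphic_map (seq_space ?S) (seq_space ?S) ?T"
  \<comment> \<open>The map is its own inverse, so its continuity also gives that of the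
    inverse.\<close>
  proof (rule homeomorphic_map_involution)
    show "continuous_map (seq_space ?S) (seq_space ?S) ?T"
      unfolding T by (rule continuous_map_seq_space_sliding_pair) (rule flip_before2_closed)
    show "\<And>s. s \<in> topspace (seq_space ?S) \<Longrightarrow> ?T (?T s) = s"
      unfolding T by (simp add: flip_before2_involution)
  qed
  ultimately show ?thesis
    by blast
qed

end
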